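(* For every finite set of formulas $\Gamma$ and every formula $\phi$: if $\Gamma\vdash\phi$ (classical consequence), then $\Gamma\Vdash\phi$ (validity in the base-extension semantics).
   Context: Let $\mathbb{C}$ be a denumerable set of contents and $\mathbb{L}=\{c^+,c^-: c\in\mathbb{C}\}$ the literals. Formulas: literals, $\bot$, $\top$, and $\phi\land\psi$, $\phi\lor\psi$, $\phi\to\psi$. Duality: $(c^+)^\bot=c^-$, $(c^-)^\bot=c^+$, $\bot^\bot=\top$, $\top^\bot=\bot$, $(\phi\land\psi)^\bot=\phi^\bot\lor\psi^\bot$, $(\phi\lor\psi)^\bot=\phi^\bot\land\psi^\bot$, $(\phi\to\psi)^\bot=\phi\land\psi^\bot$. Classical consequence: a valuation is $v:\mathbb{L}\to\{0,1\}$ with $v(c^-)=1-v(c^+)$, extended by $v(\bot)=0$, $v(\top)=1$, $\min$ for $\land$, $\max$ for $\lor$, $v(\phi\to\psi)=\max\{1-v(\phi),v(\psi)\}$; $\Gamma\vdash\phi$ iff every valuation giving value $1$ to all members of $\Gamma$ gives $\phi$ value $1$. Bases: an atomic rule is $(L_1\Rightarrow l_1),\ldots,(L_n\Rightarrow l_n)\Rightarrow l$ ($n\ge0$, $l,l_i\in\mathbb{L}$, $L_i\subseteq\mathbb{L}$ finite); a base is a set of atomic rules. Derivability $L\vdash_{\mathcal{B}} l$ ($L\subseteq\mathbb{L}$ finite, $l\in\mathbb{L}\cup\{\bot\}$) is the smallest relation closed under: (REF) $l\in L$ gives $L\vdash_{\mathcal{B}} l$; (APP$_1$) $(\Rightarrow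 l)\in\mathcal{B}$ gives $L\vdash_{\mathcal{B}} l$; (APP$_2$) if $(L_1\Rightarrow l_1),\ldots,(L_n\Rightarrow l_n)\Rightarrow l\in\mathcal{B}$ and $L\cup L_i\vdash_{\mathcal{B}} l_i$ for all $i$ then $L\vdash_{\mathcal{B}} l$; (ABS) $L\vdash_{\mathcal{B}} m$ and $L\vdash_{\mathcal{B}} m^\bot$ give $L\vdash_{\mathcal{B}}\bot$; (DM) $L\cup\{m\}\vdash_{\mathcal{B}}\bot$ gives $L\vdash_{\mathcal{B}} m^\bot$. Support (defined by induction on logical weight): $\Vdash_{\mathcal{B}} l$ iff $\emptyset\vdash_{\mathcal{B}} l$ for $l\in\mathbb{L}$; $\Vdash_{\mathcal{B}}\bot$ iff $\emptyset\vdash_{\mathcal{B}} l$ for all $l\in\mathbb{L}$; $\Vdash_{\mathcal{B}}\top$ always; $\Vdash_{\mathcal{B}}\phi\to\psi$ iff $\{\phi\}\Vdash_{\mathcal{B}}\psi$; $\Vdash_{\mathcal{B}}\phi\land\psi$ iff $\Vdash_{\mathcal{B}}\phi$ and $\Vdash_{\mathcal{B}}\psi$; $\Vdash_{\mathcal{B}}\phi\lor\psi$ iff for all bases $\mathcal{C}\supseteq\mathcal{B}$ and all $l\in\mathbb{L}$, if $\{\phi\}\Vdash_{\mathcal{C}} l$ and $\{\psi\}\Vdash_{\mathcal{C}} l$ then $\Vdash_{\mathcal{C}} l$; for a nonempty finite set $\Delta$, $\Delta\Vdash_{\mathcal{B}}\phi$ iff for all bases $\mathcal{C}\supseteq\mathcal{B}$,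 if $\Vdash_{\mathcal{C}}\delta$ for every $\delta\in\Delta$ then $\Vdash_{\mathcal{C}}\phi$; $\emptyset\Vdash_{\mathcal{B}}\phi$ means $\Vdash_{\mathcal{B}}\phi$. Finally $\Gamma\Vdash\phi$ iff $\Gamma\Vdash_{\mathcal{B}}\phi$ for every base $\mathcal{B}$. *)

theory Defs
  imports Main "HOL-Library.FSet" "HOL-Library.Countable" "HOL-Library.Infinite_Typeclass"
begin

datatype 'c literal = Pos 'c | Neg 'c

datatype 'c form =
    Lit "'c literal"
  | Bot
  | Top
  | And "'c form" "'c form"
  | Or "'c form" "'c form"
  | Imp "'c form" "'c form"

fun dual :: "'c literal \<Rightarrow> 'c literal" where
  "dual (Pos c) = Neg c"
| "dual (Neg c) = Pos c"


section \<open>Classical consequence\<close>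

definition valuation :: "('c literal \<Rightarrow> nat) \<Rightarrow> bool" where
  "valuation v \<longleftrightarrow> (\<forall>l. v l \<in> {0, 1}) \<and> (\<forall>c. v (Neg c) = 1 - v (Pos c))"

primrec val :: "('c literal \<Rightarrow> nat) \<Rightarrow> 'c form \<Rightarrow> nat" where
  "val v (Lit l) = v l"
| "val v Bot = 0"
| "val v Top = 1"
| "val v (And \<phi> \<psi>) = min (val v \<phi>) (val v \<psi>)"
| "val v (Or \<phi> \<psi>) = max (val v \<phi>) (val v \<psi>)"
| "val v (Imp \<phi> \<psi>) = max (1 - val v \<phi>) (val v \<psi>)"

definition classical_consequence :: "'c form set \<Rightarrow> 'c form \<Rightarrow> bool" where
  "classical_consequence \<Gamma> \<phi> \<longleftrightarrow>
     (\<forall>v. valuation v \<longrightarrow> (\<forall>\<gamma>\<in>\<Gamma>. val v \<gamma> = 1) \<longrightarrow> val v \<phi> = 1)"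


section \<open>Bases and derivability\<close>

text \<open>\<open>Rule [(L1, l1), \<dots>, (Ln, ln)] l\<close> is the atomic rule
  \<open>(L1 \<Rightarrow> l1), \<dots>, (Ln \<Rightarrow> ln) \<Rightarrow> l\<close>.\<close>

datatype 'c rule = Rule "('c literal fset \<times> 'c literal) list" "'c literal"

type_synonym 'c base = "'c rule set"

text \<open>Derivations conclude a literal or \<open>\<bottom>\<close>, whereas the conclusions of
  atomic rules are literals only.\<close>

datatype 'c concl = CLit "'c literal" | CBot

inductive derives :: "'c base \<Rightarrow> 'c literal fset \<Rightarrow> 'c concl \<Rightarrow> bool" for \<B> where
  REF: "l |\<in>| L \<Longrightarrow> derives \<B> L (CLit l)"
| APP1: "Rule [] l \<in> \<B> \<Longrightarrow> derives \<B> L (CLit l)"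
| APP2: "Rule ps l \<in> \<B> \<Longrightarrow> (\<And>K k. (K, k) \<in> set ps \<Longrightarrow> derives \<B> (L |\<union>| K) (CLit k)) \<Longrightarrow>
    derives \<B> L (CLit l)"
| ABS: "derives \<B> L (CLit m) \<Longrightarrow> derives \<B> L (CLit (dual m)) \<Longrightarrow> derives \<B> L CBot"
| DM: "derives \<B> (L |\<union>| {|m|}) CBot \<Longrightarrow> derives \<B> L (CLit (dual m))"


section \<open>Support\<close>

text \<open>In the clauses for \<open>Or\<close> and \<open>Imp\<close>, support relative to a singleton and support of a
  literal are written out, so that the recursion is structural; \<open>support_Or\<close> and
  \<open>support_Imp\<close> below restate these clauses in terms of \<open>supports\<close>.\<close>

primrec support :: "'c base \<Rightarrow> 'c form \<Rightarrow> bool" where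
  "support \<B> (Lit l) \<longleftrightarrow> derives \<B> {||} (CLit l)"
| "support \<B> Bot \<longleftrightarrow> (\<forall>l. derives \<B> {||} (CLit l))"
| "support \<B> Top \<longleftrightarrow> True"
| "support \<B> (And \<phi> \<psi>) \<longleftrightarrow> support \<B> \<phi> \<and> support \<B> \<psi>"
| "support \<B> (Or \<phi> \<psi>) \<longleftrightarrow>
     (\<forall>\<C> l. \<B> \<subseteq> \<C> \<longrightarrow>
        (\<forall>\<D>. \<C> \<subseteq> \<D> \<longrightarrow> support \<D> \<phi> \<longrightarrow> derives \<D> {||} (CLit l)) \<longrightarrow>
        (\<forall>\<D>. \<C> \<subseteq> \<D> \<longrightarrow> support \<D> \<psi> \<longrightarrow> derives \<D> {||} (CLit l)) \<longrightarrow>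
        derives \<C> {||} (CLit l))"
| "support \<B> (Imp \<phi> \<psi>) \<longleftrightarrow> (\<forall>\<C>. \<B> \<subseteq> \<C> \<longrightarrow> support \<C> \<phi> \<longrightarrow> support \<C> \<psi>)"

definition supports :: "'c base \<Rightarrow> 'c form set \<Rightarrow> 'c form \<Rightarrow> bool" where
  "supports \<B> \<Delta> \<phi> \<longleftrightarrow>
     (if \<Delta> = {} then support \<B> \<phi>
      else \<forall>\<C>. \<B> \<subseteq> \<C> \<longrightarrow> (\<forall>\<delta>\<in>\<Delta>. support \<C> \<delta>) \<longrightarrow> support \<C> \<phi>)"

lemma support_Or:
  "support \<B> (Or \<phi> \<psi>) \<longleftrightarrow>
     (\<forall>\<C> l. \<B> \<subseteq> \<C> \<longrightarrow> supports \<C> {\<phi>} (Lit l) \<and> supports \<C> {\<psi>} (Lit l) \<longrightarrow> support \<C> (Lit l))"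
  by (simp add: supports_def imp_conjL)

lemma support_Imp: "support \<B> (Imp \<phi> \<psi>) \<longleftrightarrow> supports \<B> {\<phi>} \<psi>"
  by (simp add: supports_def)

definition valid :: "'c form set \<Rightarrow> 'c form \<Rightarrow> bool" where
  "valid \<Gamma> \<phi> \<longleftrightarrow> (\<forall>\<B>. supports \<B> \<Gamma> \<phi>)"

end

(* Every unsupported formula has a consistent extension of the base none of whose consistent
   extensions supports the formula: for a literal l, add the rule (=> dual l), which is consistent
   by DM; for a disjunction, apply this to the literal witnessing the failure.  Such an extension
   can be enlarged, still consistently, so as to decide the finitely many contents of the formulas
   involved.  Over a base that decides these contents, support is truth under the valuation read
   off the base. *)
theory Submission imports Defs begin

lemma dual_dual [simp]: "dual (dual l) = l"
  by (cases l) auto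

subsection \<open>Derivability\<close>

lemma derives_weaken: "derives \<B> L x \<Longrightarrow> L |\<subseteq>| L' \<Longrightarrow> derives \<B> L' x"
proof (induction arbitrary: L' rule: derives.induct)
  case (APP2 ps l L)
  show ?case
  proof (rule derives.APP2[OF APP2.hyps(1)])
    fix K k assume "(K, k) \<in> set ps"
    moreover have "L |\<union>| K |\<subseteq>| L' |\<union>| K" using APP2.prems by blast
    ultimately show "derives \<B> (L' |\<union>| K) (CLit k)" by (rule APP2.IH)
  qed
next
  case (DM L m)
  have "L |\<union>| {|m|} |\<subseteq>| L' |\<union>| {|m|}" using DM.prems by blast
  then show ?case by (rule derives.DM[OF DM.IH])
qed (auto intro: derives.REF derives.APP1 derives.ABS derives.DM)

lemma derives_mono: "derives \<B> L x \<Longrightarrow> \<B> \<subseteq> \<C> \<Longrightarrow> derives \<C> L x"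
proof (induction rule: derives.induct)
  case (APP2 ps l L)
  then show ?case by (intro derives.APP2[of ps l]) auto
qed (auto intro: derives.REF derives.APP1 derives.ABS derives.DM)

text \<open>A deduction theorem for literals: every appeal to the new axiom becomes an appeal to the
  hypothesis \<open>l\<close> by REF. Going up a derivation, contexts only grow, so this hypothesis
  is present wherever it is needed.\<close>

lemma derives_insert_axiom:
  "derives (insert (Rule [] l) \<B>) L x \<Longrightarrow> derives \<B> (L |\<union>| {|l|}) x"
proof (induction rule: derives.induct)
  case (APP1 k L)
  then show ?case by (auto intro: derives.REF derives.APP1)
next
  case (APP2 ps k L)
  show ?case
  proof (cases "Rule ps k \<in> \<B>")
    case True
    then show ?thesis
    proof (rule derives.APP2)
      fix J j assume "(J, j) \<in> set ps"
      then have "derives \<B> (L |\<union>| J |\<union>| {|l|}) (CLit j)" by (rule APP2.IH)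
      then show "derives \<B> (L |\<union>| {|l|} |\<union>| J) (CLit j)"
        by (rule derives_weaken) blast
    qed
  next
    \<comment> \<open>The rule applied is then the added axiom itself, so \<open>k\<close> is
      \<open>l\<close>.\<close>
    case False
    with APP2.hyps(1) show ?thesis by (auto intro: derives.REF)
  qed
next
  case (DM L m)
  have "derives \<B> (L |\<union>| {|l|} |\<union>| {|m|}) CBot"
    using DM.IH by (rule derives_weaken) blast
  then show ?case by (rule derives.DM)
qed (auto intro: derives.REF derives.ABS)

text \<open>DM may discharge a hypothesis that was added by weakening only; discharging
  \<open>dual l\<close> leaves \<open>l\<close>.\<close>

lemma derives_ex_falso:
  assumes "derives \<B> L CBot"
  shows "derives \<B> L (CLit l)"
proof -
  have "derives \<B> (L |\<union>| {|dual l|}) CBot"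
    using assms by (rule derives_weaken) blast
  then have "derives \<B> L (CLit (dual (dual l)))" by (rule derives.DM)
  then show ?thesis by simp
qed

definition consistent :: "'c base \<Rightarrow> bool" where
  "consistent \<B> \<longleftrightarrow> \<not> derives \<B> {||} CBot"

lemma consistent_mono: "consistent \<C> \<Longrightarrow> \<B> \<subseteq> \<C> \<Longrightarrow> consistent \<B>"
  by (auto simp: consistent_def intro: derives_mono)

lemma consistent_not_both:
  "consistent \<B> \<Longrightarrow> derives \<B> {||} (CLit l) \<Longrightarrow> \<not> derives \<B> {||} (CLit (dual l))"
  by (auto simp: consistent_def intro: derives.ABS)

text \<open>A contradiction from the axiom \<open>l\<close> is a contradiction from the hypothesis
  \<open>l\<close>, and DM turns that into a derivation of \<open>dual l\<close>.\<close>

lemma consistent_insert_axiom: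
  assumes "\<not> derives \<B> {||} (CLit (dual l))"
  shows "consistent (insert (Rule [] l) \<B>)"
  unfolding consistent_def
proof
  assume "derives (insert (Rule [] l) \<B>) {||} CBot"
  from derives.DM[OF derives_insert_axiom[OF this]] assms show False by blast
qed

text \<open>The left side is the support clause for \<open>Bot\<close>, so this identifies
  supporting \<open>Bot\<close> with being inconsistent.\<close>

lemma derives_all_iff: "(\<forall>l. derives \<B> {||} (CLit l)) \<longleftrightarrow> \<not> consistent \<B>"
  unfolding consistent_def using derives_ex_falso derives.ABS by metis

subsection \<open>Support\<close>

text \<open>The clauses for \<open>Or\<close> and \<open>Imp\<close> already range over all
  extensions, so these cases follow from transitivity of inclusion.\<close>

lemma support_mono: "support \<B> \<phi> \<Longrightarrow> \<B> \<subseteq> \<C> \<Longrightarrow> support \<C> \<phi>"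
proof (induction \<phi>)
  case (Or \<phi> \<psi>)
  show ?case unfolding support.simps(5)
  proof (intro allI impI)
    fix \<D> l
    assume "\<C> \<subseteq> \<D>"
      and *: "\<forall>\<E>. \<D> \<subseteq> \<E> \<longrightarrow> support \<E> \<phi> \<longrightarrow> derives \<E> {||} (CLit l)"
        "\<forall>\<E>. \<D> \<subseteq> \<E> \<longrightarrow> support \<E> \<psi> \<longrightarrow> derives \<E> {||} (CLit l)"
    then have "\<B> \<subseteq> \<D>" using Or.prems(2) by blast
    with Or.prems(1) * show "derives \<D> {||} (CLit l)" unfolding support.simps(5) by metis
  qed
next
  case (Imp \<phi> \<psi>)
  have "support \<D> \<psi>" if "\<C> \<subseteq> \<D>" "support \<D> \<phi>" for \<D>
    using Imp.prems(1) that subset_trans[OF Imp.prems(2) that(1)] by simp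
  then show ?case by simp
next
  case (Lit l)
  then show ?case by (auto intro: derives_mono)
next
  case Bot
  then show ?case by (auto intro: derives_mono)
qed auto

text \<open>Ex falso at the level of support. It disposes of the inconsistent extensions over which
  the clause for \<open>Imp\<close> also ranges.\<close>

lemma inconsistent_support: "\<not> consistent \<B> \<Longrightarrow> support \<B> \<phi>"
proof (induction \<phi> arbitrary: \<B>)
  case (Or \<phi> \<psi>)
  have "derives \<C> {||} (CLit l)" if "\<B> \<subseteq> \<C>" for \<C> l
    using that Or.prems consistent_mono derives_all_iff by blast
  then show ?case by simp
next
  case (Imp \<phi> \<psi>)
  have "support \<C> \<psi>" if "\<B> \<subseteq> \<C>" for \<C>
    using that Imp.prems Imp.IH(2) consistent_mono by blast
  then show ?case by simp
qed (simp_all add: derives_all_iff derives_all_iff[THEN iffD2, rule_format])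

text \<open>Once \<open>dual l\<close> is an axiom, deriving \<open>l\<close> in an extension makes
  that extension inconsistent by ABS.\<close>

lemma derives_refutable:
  assumes "\<not> derives \<B> {||} (CLit l)"
  obtains \<C> where "\<B> \<subseteq> \<C>" "consistent \<C>"
    "\<And>\<D>. \<C> \<subseteq> \<D> \<Longrightarrow> consistent \<D> \<Longrightarrow> \<not> derives \<D> {||} (CLit l)"
proof
  let ?C = "insert (Rule [] (dual l)) \<B>"
  show "\<B> \<subseteq> ?C" by blast
  show "consistent ?C" using assms by (intro consistent_insert_axiom) simp
  fix \<D> assume "?C \<subseteq> \<D>" "consistent \<D>"
  then show "\<not> derives \<D> {||} (CLit l)"
    using consistent_not_both[of \<D> l] derives.APP1[of "dual l" \<D>] by blast
qed

text \<open>This is where support is classical: read contrapositively, a formula supported by some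
  consistent extension of each consistent extension of a base is supported by the base
  itself.\<close>

lemma support_refutable:
  "\<not> support \<B> \<phi> \<Longrightarrow>
   \<exists>\<C>. \<B> \<subseteq> \<C> \<and> consistent \<C> \<and> (\<forall>\<D>. \<C> \<subseteq> \<D> \<longrightarrow> consistent \<D> \<longrightarrow> \<not> support \<D> \<phi>)"
proof (induction \<phi> arbitrary: \<B>)
  case (Lit l)
  then have "\<not> derives \<B> {||} (CLit l)" by simp
  then show ?case unfolding support.simps(1) by (rule derives_refutable) blast
next
  case Bot
  \<comment> \<open>Here \<open>\<B>\<close> is its own witness: it is consistent, and no consistent
    base supports \<open>Bot\<close>.\<close>
  then show ?case by (auto simp: derives_all_iff)
next
  case Top
  then show ?case by simp
next
  case (And \<phi> \<psi>)
  from And.prems consider "\<not> support \<B> \<phi>" | "\<not> support \<B> \<psi>" by auto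
  then show ?case
  proof cases
    case 1
    from And.IH(1)[OF this] show ?thesis unfolding support.simps(4) by blast
  next
    case 2
    from And.IH(2)[OF this] show ?thesis unfolding support.simps(4) by blast
  qed
next
  case (Or \<phi> \<psi>)
  then obtain \<C> l where C: "\<B> \<subseteq> \<C>"
    "\<And>\<D>. \<C> \<subseteq> \<D> \<Longrightarrow> support \<D> \<phi> \<Longrightarrow> derives \<D> {||} (CLit l)"
    "\<And>\<D>. \<C> \<subseteq> \<D> \<Longrightarrow> support \<D> \<psi> \<Longrightarrow> derives \<D> {||} (CLit l)"
    "\<not> derives \<C> {||} (CLit l)" by auto
  from derives_refutable[OF C(4)] obtain \<D> where D: "\<C> \<subseteq> \<D>" "consistent \<D>"
    "\<And>\<E>. \<D> \<subseteq> \<E> \<Longrightarrow> consistent \<E> \<Longrightarrow> \<not> derives \<E> {||} (CLit l)" by blast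
  have "\<not> support \<E> (Or \<phi> \<psi>)" if "\<D> \<subseteq> \<E>" "consistent \<E>" for \<E>
  proof
    assume "support \<E> (Or \<phi> \<psi>)"
    \<comment> \<open>Both disjuncts still yield \<open>l\<close> above \<open>\<E>\<close>, so
      support of the disjunction would yield \<open>l\<close> at \<open>\<E>\<close>.\<close>
    then have "derives \<E> {||} (CLit l)"
      using C(2,3) D(1) \<open>\<D> \<subseteq> \<E>\<close> by (simp add: subset_iff)
    with D(3) that show False by blast
  qed
  with C(1) D(1,2) show ?case by blast
next
  case (Imp \<phi> \<psi>)
  then obtain \<C> where C: "\<B> \<subseteq> \<C>" "support \<C> \<phi>" "\<not> support \<C> \<psi>" by auto
  \<comment> \<open>Refuting \<open>\<psi>\<close> is enough, since \<open>\<phi>\<close> remains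
    supported in all extensions of \<open>\<C>\<close>.\<close>
  from Imp.IH(2)[OF C(3)] obtain \<D> where D: "\<C> \<subseteq> \<D>" "consistent \<D>"
    "\<forall>\<E>. \<D> \<subseteq> \<E> \<longrightarrow> consistent \<E> \<longrightarrow> \<not> support \<E> \<psi>" by blast
  have "\<not> support \<E> (Imp \<phi> \<psi>)" if "\<D> \<subseteq> \<E>" "consistent \<E>" for \<E>
    using that D(1,3) support_mono[OF C(2)] by auto
  with C(1) D(1,2) show ?case by blast
qed

subsection \<open>Deciding bases\<close>

primrec content :: "'c literal \<Rightarrow> 'c" where
  "content (Pos c) = c"
| "content (Neg c) = c"

primrec contents :: "'c form \<Rightarrow> 'c set" where
  "contents (Lit l) = {content l}"
| "contents Bot = {}"
| "contents Top = {}"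
| "contents (And \<phi> \<psi>) = contents \<phi> \<union> contents \<psi>"
| "contents (Or \<phi> \<psi>) = contents \<phi> \<union> contents \<psi>"
| "contents (Imp \<phi> \<psi>) = contents \<phi> \<union> contents \<psi>"

lemma finite_contents: "finite (contents \<phi>)"
  by (induction \<phi>) auto

definition decides :: "'c base \<Rightarrow> 'c set \<Rightarrow> bool" where
  "decides \<B> S \<longleftrightarrow> (\<forall>c\<in>S. derives \<B> {||} (CLit (Pos c)) \<or> derives \<B> {||} (CLit (Neg c)))"

lemma deciding_extension:
  assumes "finite S" "consistent \<B>"
  shows "\<exists>\<C>. \<B> \<subseteq> \<C> \<and> consistent \<C> \<and> decides \<C> S"
  using assms(1)
proof (induction S)
  case empty
  with assms(2) show ?case by (auto simp: decides_def)
next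
  case (insert c S)
  then obtain \<C> where C: "\<B> \<subseteq> \<C>" "consistent \<C>" "decides \<C> S" by blast
  show ?case
  proof (cases "derives \<C> {||} (CLit (Neg c))")
    case True
    with C show ?thesis by (auto simp: decides_def)
  next
    \<comment> \<open>Underivability of \<open>Neg c\<close> is exactly what makes the axiom
      \<open>Pos c\<close> safe to add.\<close>
    case False
    let ?D = "insert (Rule [] (Pos c)) \<C>"
    have "consistent ?D" using False by (intro consistent_insert_axiom) simp
    moreover have "decides ?D (insert c S)"
      using C(3) derives_mono[of \<C> _ _ ?D] derives.APP1[of "Pos c" ?D]
      unfolding decides_def by blast
    ultimately show ?thesis using C(1) by blast
  qed
qed

text \<open>Negative literals get the complementary value by definition, so this is a valuation for
  every base. That value 1 on \<open>Neg c\<close> agrees with derivability of \<open>Neg c\<close>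
  requires a consistent base that decides \<open>c\<close>.\<close>

fun base_valuation :: "'c base \<Rightarrow> 'c literal \<Rightarrow> nat" where
  "base_valuation \<B> (Pos c) = of_bool (derives \<B> {||} (CLit (Pos c)))"
| "base_valuation \<B> (Neg c) = 1 - of_bool (derives \<B> {||} (CLit (Pos c)))"

lemma valuation_base_valuation: "valuation (base_valuation \<B>)"
proof -
  have "base_valuation \<B> l \<in> {0, 1}" for l by (cases l) auto
  then show ?thesis by (auto simp: valuation_def)
qed

lemma val_cases: "valuation v \<Longrightarrow> val v \<phi> = 0 \<or> val v \<phi> = 1"
  by (induction \<phi>) (auto simp: valuation_def)

text \<open>The valuation is fixed by \<open>\<B>\<close> while \<open>\<C>\<close> ranges over its
  consistent extensions, because the clauses for \<open>Or\<close> and \<open>Imp\<close> look at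
  extensions. All these bases derive the same literals with content in \<open>S\<close>: what
  \<open>\<B>\<close> derives persists, and consistency excludes the duals.\<close>

lemma support_iff_val:
  assumes "contents \<phi> \<subseteq> S" "decides \<B> S" "\<B> \<subseteq> \<C>" "consistent \<C>"
  shows "support \<C> \<phi> \<longleftrightarrow> val (base_valuation \<B>) \<phi> = 1"
  using assms(1,3,4)
proof (induction \<phi> arbitrary: \<C>)
  case (Lit l)
  let ?c = "content l"
  have "derives \<B> {||} (CLit (Pos ?c)) \<or> derives \<B> {||} (CLit (Neg ?c))"
    using assms(2) Lit.prems(1) by (auto simp: decides_def)
  moreover have "derives \<B> {||} x \<Longrightarrow> derives \<C> {||} x" for x
    using Lit.prems(2) derives_mono by blast
  moreover have "\<not> (derives \<C> {||} (CLit (Pos ?c)) \<and> derives \<C> {||} (CLit (Neg ?c)))"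
    using consistent_not_both[OF Lit.prems(3), of "Pos ?c"] by auto
  ultimately show ?case by (cases l) auto
next
  case Bot
  then show ?case by (simp add: derives_all_iff)
next
  case Top
  then show ?case by simp
next
  case (And \<phi> \<psi>)
  have "support \<C> (And \<phi> \<psi>) \<longleftrightarrow>
      val (base_valuation \<B>) \<phi> = 1 \<and> val (base_valuation \<B>) \<psi> = 1"
    using And by simp
  then show ?case
    using val_cases[OF valuation_base_valuation, of \<B> \<phi>]
      val_cases[OF valuation_base_valuation, of \<B> \<psi>] by auto
next
  case (Or \<phi> \<psi>)
  let ?v = "val (base_valuation \<B>)"
  have v01: "?v \<phi> = 0 \<or> ?v \<phi> = 1" "?v \<psi> = 0 \<or> ?v \<psi> = 1"
    using val_cases valuation_base_valuation by blast+
  have IH: "support \<C> \<phi> \<longleftrightarrow> ?v \<phi> = 1" "support \<C> \<psi> \<longleftrightarrow> ?v \<psi> = 1"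
    if "\<B> \<subseteq> \<C>" "consistent \<C>" for \<C> using Or.IH Or.prems(1) that by auto
  show ?case
  proof
    assume supp: "support \<C> (Or \<phi> \<psi>)"
    show "?v (Or \<phi> \<psi>) = 1"
    proof (rule ccontr)
      assume "?v (Or \<phi> \<psi>) \<noteq> 1"
      then have "?v \<phi> \<noteq> 1" "?v \<psi> \<noteq> 1" using v01 by auto
      then have "\<not> support \<D> \<phi>" "\<not> support \<D> \<psi>" if "\<C> \<subseteq> \<D>" "consistent \<D>" for \<D>
        using IH that Or.prems(2) by blast+
      \<comment> \<open>If both disjuncts are false, only inconsistent extensions support either of
        them, and these derive every \<open>l\<close>. The disjunction then forces every literal on
        \<open>\<C>\<close>, against its consistency.\<close>
      then have "derives \<D> {||} (CLit l)" if "\<C> \<subseteq> \<D>" "support \<D> \<phi> \<or> support \<D> \<psi>" for \<D> l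
        using that derives_all_iff by blast
      then have "derives \<C> {||} (CLit l)" for l using supp unfolding support.simps(5) by blast
      then show False using derives_all_iff Or.prems(3) by blast
    qed
  next
    assume "?v (Or \<phi> \<psi>) = 1"
    then have "?v \<phi> = 1 \<or> ?v \<psi> = 1" by (simp add: max_def split: if_splits)
    then have "support \<C> \<phi> \<or> support \<C> \<psi>" using IH Or.prems(2,3) by blast
    then have "support \<D> \<phi> \<or> support \<D> \<psi>" if "\<C> \<subseteq> \<D>" for \<D>
      using that support_mono by blast
    then show "support \<C> (Or \<phi> \<psi>)" by auto
  qed
next
  case (Imp \<phi> \<psi>)
  let ?v = "val (base_valuation \<B>)"
  have v01: "?v \<phi> = 0 \<or> ?v \<phi> = 1" "?v \<psi> = 0 \<or> ?v \<psi> = 1"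
    using val_cases valuation_base_valuation by blast+
  have IH: "support \<C> \<phi> \<longleftrightarrow> ?v \<phi> = 1" "support \<C> \<psi> \<longleftrightarrow> ?v \<psi> = 1"
    if "\<B> \<subseteq> \<C>" "consistent \<C>" for \<C> using Imp.IH Imp.prems(1) that by auto
  have "support \<C> (Imp \<phi> \<psi>) \<longleftrightarrow> (?v \<phi> = 1 \<longrightarrow> ?v \<psi> = 1)"
  proof
    assume "support \<C> (Imp \<phi> \<psi>)"
    then show "?v \<phi> = 1 \<longrightarrow> ?v \<psi> = 1" using IH[of \<C>] Imp.prems(2,3) by auto
  next
    assume imp: "?v \<phi> = 1 \<longrightarrow> ?v \<psi> = 1"
    have "support \<D> \<psi>" if "\<C> \<subseteq> \<D>" "support \<D> \<phi>" for \<D>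
      \<comment> \<open>A consistent \<open>\<D>\<close> is covered by the induction hypotheses, an
        inconsistent one by ex falso.\<close>
      using that imp IH[of \<D>] inconsistent_support[of \<D>] Imp.prems(2) by blast
    then show "support \<C> (Imp \<phi> \<psi>)" by simp
  qed
  also have "\<dots> \<longleftrightarrow> ?v (Imp \<phi> \<psi>) = 1" using v01 by auto
  finally show ?case .
qed

theorem mainTheorem6:
  fixes \<Gamma> :: "'c::{countable, infinite} form set" and \<phi> :: "'c form"
  assumes "finite \<Gamma>"
    and "classical_consequence \<Gamma> \<phi>"
  shows "valid \<Gamma> \<phi>"
proof -
  \<comment> \<open>Preserving support at each single base is enough, since validity ranges over all
    bases anyway.\<close>
  have "support \<B> \<phi>" if \<Gamma>: "\<forall>\<gamma>\<in>\<Gamma>. support \<B> \<gamma>" for \<B>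
  proof (rule ccontr)
    assume "\<not> support \<B> \<phi>"
    from support_refutable[OF this] obtain \<C> where C: "\<B> \<subseteq> \<C>" "consistent \<C>"
      "\<And>\<D>. \<C> \<subseteq> \<D> \<Longrightarrow> consistent \<D> \<Longrightarrow> \<not> support \<D> \<phi>"
      by blast
    \<comment> \<open>Finiteness of \<open>\<Gamma>\<close> enters here: only finitely many contents
      have to be decided, so finitely many added axioms suffice.\<close>
    define S where "S = (\<Union>\<psi>\<in>insert \<phi> \<Gamma>. contents \<psi>)"
    have "finite S" using assms(1) by (simp add: S_def finite_contents)
    then obtain \<D> where D: "\<C> \<subseteq> \<D>" "consistent \<D>" "decides \<D> S"
      using deciding_extension C(2) by blast
    have truth: "support \<D> \<psi> \<longleftrightarrow> val (base_valuation \<D>) \<psi> = 1" if "\<psi> \<in> insert \<phi> \<Gamma>" for \<psi>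
      using that by (intro support_iff_val[OF _ D(3) subset_refl D(2)]) (auto simp: S_def)
    have "\<forall>\<gamma>\<in>\<Gamma>. support \<D> \<gamma>"
      using \<Gamma> support_mono subset_trans[OF C(1) D(1)] by blast
    then have "val (base_valuation \<D>) \<phi> = 1"
      using assms(2) truth valuation_base_valuation unfolding classical_consequence_def by blast
    then show False using truth C(3) D(1,2) by blast
  qed
  then show ?thesis by (auto simp: valid_def supports_def)
qed

end
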